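(* Let $A\in V$. Then there exists $B\in V$ such that $[B]\in\hat V$ is a staircase character and $\mathbb C\mathcal O_A\cong\mathbb C\mathcal O_B$ as $\mathbb C U$-modules.
   Context: Let $p$ be an odd prime, $q$ a power of $p$, $n$ a natural number. Fix one of the types $\mathfrak B_n,\mathfrak C_n,\mathfrak D_n$; set $N=2n+1$ for $\mathfrak B_n$ and $N=2n$ for $\mathfrak C_n,\mathfrak D_n$. Put $\bar i=N+1-i$. Let $S=\sum_{i=1}^n e_{i\bar i}+\sum_{i=n+1}^N\epsilon e_{i\bar i}$, where $e_{ij}$ are the $N\times N$ matrix units, $\epsilon=-1$ for type $\mathfrak C_n$ and $\epsilon=1$ otherwise, and $G=\{g\in GL_N(q)\mid g^tSg=S\}$. Let $\widetilde U=U_N(q)$ be the group of upper unitriangular $N\times N$ matrices over $\mathbb F_q$ and $U=G\cap\widetilde U$. Let $\mathcal P=\{(i,j)\mid 1\le i<j<\bar i\}$ for types $\mathfrak B_n,\mathfrak D_n$ and $\mathcal P=\{(i,j)\mid 1\le i<j\le\bar i\}$ for type $\mathfrak C_n$. Let $V=\bigoplus_{(i,j)\in\mathcal P}\mathbb F_q e_{ij}$ and $\pi:\mathrm{Mat}_{N\times N}(\mathbb F_q)\to V$ the projection setting entries outside $\mathcal P$ to zero; $\kappa(A,B)=\mathrm{tr}(A^tB)$. Fix a nontrivial linear character $\theta:(\mathbb F_q,+)\to\mathbb C^*$. For $A\in V$ let $[A]:V\to\mathbb C^*$ be the linear character $[A](B)=\theta(-\kappa(A,B))$; $\hat V=\{[A]\mid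 A\in V\}$ is the set of linear characters of $(V,+)$, a basis of $\mathbb C\hat V=\mathbb C^V$. The group $\widetilde U$ (hence $U$) permutes $\hat V$ by $[A].u=[\pi(Au^{-t})]$, $u^{-t}=(u^{-1})^t$, and acts linearly on $\mathbb C\hat V$ from the right by the monomial action $[A]u=\theta(-\kappa(A,u^{-1}))\,[A].u$. For $A\in V$, $\mathcal O_A=\{[A].u\mid u\in U\}$ is the $U$-orbit and $\mathbb C\mathcal O_A$ (the span of $\mathcal O_A$) is the corresponding $\mathbb C U$-module under the monomial action. A position $(i,j)\in\mathcal P$ is a main condition of $A$ if $A_{ij}$ is the rightmost nonzero entry in row $i$ of $A$; $\mathrm{main}(A)$ is the set of main conditions. The character $[A]$ is a staircase character if the elements of $\mathrm{main}(A)$ lie in pairwise different columns. *)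

theory Defs
  imports
    "Jordan_Normal_Form.Matrix"
    "HOL-Library.Function_Algebras"
    "HOL-Computational_Algebra.Primes"
    Complex_Main
begin

text \<open>Matrices are indexed from \<open>0\<close> to \<open>N - 1\<close>, so that a position \<open>(i, j)\<close> below stands for the
  position \<open>(i + 1, j + 1)\<close> in the usual numbering and the reflection \<open>N + 1 - i\<close> becomes
  \<open>N - 1 - i\<close>.  The field with \<open>q\<close> elements is a type \<open>'a\<close> of class \<open>field\<close> and \<open>finite\<close>.\<close>

datatype classical_type = TypeB | TypeC | TypeD

definition msize :: "classical_type \<Rightarrow> nat \<Rightarrow> nat" where
  "msize T n = (if T = TypeB then 2 * n + 1 else 2 * n)"

definition refl_idx :: "classical_type \<Rightarrow> nat \<Rightarrow> nat \<Rightarrow> nat" where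
  "refl_idx T n i = msize T n - 1 - i"

definition form_sign :: "classical_type \<Rightarrow> 'a :: field" where
  "form_sign T = (if T = TypeC then - 1 else 1)"

definition form_mat :: "classical_type \<Rightarrow> nat \<Rightarrow> 'a :: field mat" where
  "form_mat T n = mat (msize T n) (msize T n)
     (\<lambda>(i, j). if j = refl_idx T n i then (if i < n then 1 else form_sign T) else 0)"

abbreviation mat_ring :: "nat \<Rightarrow> 'a :: field mat ring" where
  "mat_ring N \<equiv> ring_mat TYPE('a) N ()"

definition classical_grp :: "classical_type \<Rightarrow> nat \<Rightarrow> 'a :: field mat set" where
  "classical_grp T n =
     {g \<in> Units (mat_ring (msize T n)). transpose_mat g * form_mat T n * g = form_mat T n}"

definition unitriangular_grp :: "nat \<Rightarrow> 'a :: field mat set" where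
  "unitriangular_grp N = {u \<in> carrier_mat N N. upper_triangular u \<and> (\<forall>i<N. u $$ (i, i) = 1)}"

definition sylow_grp :: "classical_type \<Rightarrow> nat \<Rightarrow> 'a :: field mat set" where
  "sylow_grp T n = classical_grp T n \<inter> unitriangular_grp (msize T n)"

definition positions :: "classical_type \<Rightarrow> nat \<Rightarrow> (nat \<times> nat) set" where
  "positions T n = {(i, j). i < msize T n \<and> i < j \<and>
     (if T = TypeC then j \<le> refl_idx T n i else j < refl_idx T n i)}"

definition pattern_space :: "classical_type \<Rightarrow> nat \<Rightarrow> 'a :: field mat set" where
  "pattern_space T n = {A \<in> carrier_mat (msize T n) (msize T n).
     \<forall>i < msize T n. \<forall>j < msize T n. (i, j) \<notin> positions T n \<longrightarrow> A $$ (i, j) = 0}"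

definition pattern_proj :: "classical_type \<Rightarrow> nat \<Rightarrow> 'a :: field mat \<Rightarrow> 'a mat" where
  "pattern_proj T n A = mat (msize T n) (msize T n)
     (\<lambda>(i, j). if (i, j) \<in> positions T n then A $$ (i, j) else 0)"

definition trace_mat :: "'a :: field mat \<Rightarrow> 'a" where
  "trace_mat M = (\<Sum>i<dim_row M. M $$ (i, i))"

definition kappa :: "'a :: field mat \<Rightarrow> 'a mat \<Rightarrow> 'a" where
  "kappa A B = trace_mat (transpose_mat A * B)"

definition additive_character :: "('a :: field \<Rightarrow> complex) \<Rightarrow> bool" where
  "additive_character \<theta> \<longleftrightarrow> (\<forall>x. \<theta> x \<noteq> 0) \<and> (\<forall>x y. \<theta> (x + y) = \<theta> x * \<theta> y)"

definition nontrivial_additive_character :: "('a :: field \<Rightarrow> complex) \<Rightarrow> bool" where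
  "nontrivial_additive_character \<theta> \<longleftrightarrow> additive_character \<theta> \<and> (\<exists>x. \<theta> x \<noteq> 1)"

text \<open>Complex functions on the pattern space \<open>V\<close> are represented by functions on all matrices that
  vanish outside \<open>V\<close>; the character \<open>[A]\<close> is \<open>lin_char T n \<theta> A\<close>.\<close>

definition lin_char ::
  "classical_type \<Rightarrow> nat \<Rightarrow> ('a :: field \<Rightarrow> complex) \<Rightarrow> 'a mat \<Rightarrow> 'a mat \<Rightarrow> complex" where
  "lin_char T n \<theta> A = (\<lambda>B. if B \<in> pattern_space T n then \<theta> (- kappa A B) else 0)"

definition V_hat ::
  "classical_type \<Rightarrow> nat \<Rightarrow> ('a :: field \<Rightarrow> complex) \<Rightarrow> ('a mat \<Rightarrow> complex) set" where
  "V_hat T n \<theta> = lin_char T n \<theta> ` pattern_space T n"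

definition cscale :: "complex \<Rightarrow> ('b \<Rightarrow> complex) \<Rightarrow> 'b \<Rightarrow> complex" where
  "cscale c f = (\<lambda>x. c * f x)"

global_interpretation cfun: vector_space "cscale :: complex \<Rightarrow> ('b \<Rightarrow> complex) \<Rightarrow> 'b \<Rightarrow> complex"
  by unfold_locales (auto simp: cscale_def fun_eq_iff algebra_simps)

definition char_rep ::
  "classical_type \<Rightarrow> nat \<Rightarrow> 'a :: field mat \<Rightarrow> 'a mat \<Rightarrow> 'a mat" where
  "char_rep T n A u =
     pattern_proj T n (A * transpose_mat (inv\<^bsub>mat_ring (msize T n)\<^esub> u))"

text \<open>The permutation action is \<open>[A].u = [char_rep T n A u]\<close>.  The monomial action is the linear
  extension of \<open>[A] u = \<theta> (- kappa A u\<^sup>-\<^sup>1) [A].u\<close> from the basis \<open>V_hat\<close>: the coefficient of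
  \<open>[A]\<close> in \<open>f\<close> is \<open>cfun.representation (V_hat T n \<theta>) f [A]\<close>.
  See \<open>monomial_action_lin_char\<close> and \<open>monomial_action_linear\<close> below.\<close>

definition monomial_action ::
  "classical_type \<Rightarrow> nat \<Rightarrow> ('a :: field \<Rightarrow> complex) \<Rightarrow> ('a mat \<Rightarrow> complex) \<Rightarrow> 'a mat \<Rightarrow>
     ('a mat \<Rightarrow> complex)" where
  "monomial_action T n \<theta> f u =
     (\<Sum>A \<in> pattern_space T n.
        cscale (cfun.representation (V_hat T n \<theta>) f (lin_char T n \<theta> A))
          (cscale (\<theta> (- kappa A (inv\<^bsub>mat_ring (msize T n)\<^esub> u))) (lin_char T n \<theta> (char_rep T n A u))))"

definition char_orbit ::
  "classical_type \<Rightarrow> nat \<Rightarrow> ('a :: field \<Rightarrow> complex) \<Rightarrow> 'a mat \<Rightarrow> ('a mat \<Rightarrow> complex) set" where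
  "char_orbit T n \<theta> A = {lin_char T n \<theta> (char_rep T n A u) |u. u \<in> sylow_grp T n}"

definition orbit_module ::
  "classical_type \<Rightarrow> nat \<Rightarrow> ('a :: field \<Rightarrow> complex) \<Rightarrow> 'a mat \<Rightarrow> ('a mat \<Rightarrow> complex) set" where
  "orbit_module T n \<theta> A = cfun.span (char_orbit T n \<theta> A)"

text \<open>An isomorphism of modules over the group algebra of \<open>U\<close> is a complex linear bijection that
  commutes with the action of every element of \<open>U\<close>.\<close>

definition CU_isomorphic ::
  "classical_type \<Rightarrow> nat \<Rightarrow> ('a :: field \<Rightarrow> complex) \<Rightarrow>
     ('a mat \<Rightarrow> complex) set \<Rightarrow> ('a mat \<Rightarrow> complex) set \<Rightarrow> bool" where
  "CU_isomorphic T n \<theta> M M' \<longleftrightarrow>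
     (\<exists>\<phi>. bij_betw \<phi> M M' \<and>
          (\<forall>f\<in>M. \<forall>g\<in>M. \<phi> (f + g) = \<phi> f + \<phi> g) \<and>
          (\<forall>c. \<forall>f\<in>M. \<phi> (cscale c f) = cscale c (\<phi> f)) \<and>
          (\<forall>u\<in>sylow_grp T n. \<forall>f\<in>M.
             \<phi> (monomial_action T n \<theta> f u) = monomial_action T n \<theta> (\<phi> f) u))"

definition main_conditions :: "classical_type \<Rightarrow> nat \<Rightarrow> 'a :: field mat \<Rightarrow> (nat \<times> nat) set" where
  "main_conditions T n A = {(i, j) \<in> positions T n.
     A $$ (i, j) \<noteq> 0 \<and> (\<forall>k. j < k \<and> k < msize T n \<longrightarrow> A $$ (i, k) = 0)}"

text \<open>For a nontrivial \<open>\<theta>\<close> the matrix \<open>A\<close> is determined by the character \<open>[A]\<close>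
  (\<open>inj_on_lin_char\<close> below), so the existential quantifier is over at most one matrix.\<close>

definition staircase_character ::
  "classical_type \<Rightarrow> nat \<Rightarrow> ('a :: field \<Rightarrow> complex) \<Rightarrow> ('a mat \<Rightarrow> complex) \<Rightarrow> bool" where
  "staircase_character T n \<theta> \<xi> \<longleftrightarrow>
     (\<exists>A \<in> pattern_space T n. \<xi> = lin_char T n \<theta> A \<and> inj_on snd (main_conditions T n A))"


subsection \<open>The characters form a basis, and the monomial action is as intended\<close>

lemma kappa_eq:
  assumes "A \<in> carrier_mat N N" "B \<in> carrier_mat N N"
  shows "kappa A B = (\<Sum>i<N. \<Sum>k<N. A $$ (k, i) * B $$ (k, i))"
  using assms by (auto simp: kappa_def trace_mat_def scalar_prod_def atLeast0LessThan intro!: sum.cong)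

lemma pattern_space_carrier:
  "A \<in> pattern_space T n \<Longrightarrow> A \<in> carrier_mat (msize T n) (msize T n)"
  by (simp add: pattern_space_def)

lemma finite_pattern_space: "finite (pattern_space T n :: 'a :: {field, finite} mat set)"
proof -
  let ?N = "msize T n"
  let ?F = "({..<?N} \<times> {..<?N}) \<rightarrow>\<^sub>E (UNIV :: 'a set)"
  have "(pattern_space T n :: 'a mat set) \<subseteq> mat ?N ?N ` ?F"
  proof
    fix A :: "'a mat" assume "A \<in> pattern_space T n"
    hence c: "A \<in> carrier_mat ?N ?N" by (rule pattern_space_carrier)
    have "A = mat ?N ?N (restrict (\<lambda>p. A $$ p) ({..<?N} \<times> {..<?N}))"
      using c by (intro eq_matI) auto
    moreover have "restrict (\<lambda>p. A $$ p) ({..<?N} \<times> {..<?N}) \<in> ?F" by simp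
    ultimately show "A \<in> mat ?N ?N ` ?F" by (rule image_eqI)
  qed
  thus ?thesis by (rule finite_subset) (intro finite_imageI finite_PiE finite_cartesian_product; simp)
qed

lemma pattern_space_add:
  "A \<in> pattern_space T n \<Longrightarrow> B \<in> pattern_space T n \<Longrightarrow> A + B \<in> pattern_space T n"
  by (auto simp: pattern_space_def)

lemma pattern_space_minus:
  "A \<in> pattern_space T n \<Longrightarrow> B \<in> pattern_space T n \<Longrightarrow> A - B \<in> pattern_space T n"
  by (auto simp: pattern_space_def)

lemma pattern_proj_in: "pattern_proj T n A \<in> pattern_space T n"
  by (auto simp: pattern_space_def pattern_proj_def)

lemma character_zero: "additive_character \<theta> \<Longrightarrow> \<theta> 0 = 1"
  unfolding additive_character_def by (metis add_0 mult_cancel_right1)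

lemma kappa_nondegenerate:
  assumes \<theta>: "nontrivial_additive_character \<theta>"
    and D: "D \<in> pattern_space T n" "D \<noteq> 0\<^sub>m (msize T n) (msize T n)"
  shows "\<exists>B \<in> pattern_space T n. \<theta> (kappa D B) \<noteq> 1"
proof -
  let ?N = "msize T n"
  note c = pattern_space_carrier[OF D(1)]
  obtain a b where ab: "a < ?N" "b < ?N" "D $$ (a, b) \<noteq> 0"
    using c D(2) by (metis carrier_matD(1) carrier_matD(2) eq_matI index_zero_mat)
  hence pos: "(a, b) \<in> positions T n" using D(1) by (auto simp: pattern_space_def)
  obtain x where x: "\<theta> x \<noteq> 1" using \<theta> by (auto simp: nontrivial_additive_character_def)
  define B where "B = mat ?N ?N (\<lambda>(i, j). if i = a \<and> j = b then x / D $$ (a, b) else 0)"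
  have B: "B \<in> pattern_space T n" using pos by (auto simp: pattern_space_def B_def)
  have "kappa D B = (\<Sum>i<?N. \<Sum>k<?N. if i = b then (if k = a then x else 0) else 0)"
    unfolding kappa_eq[OF c pattern_space_carrier[OF B]]
    using ab by (intro sum.cong refl) (auto simp: B_def)
  also have "\<dots> = (\<Sum>i<?N. if i = b then (\<Sum>k<?N. if k = a then x else 0) else 0)"
    by (intro sum.cong refl) auto
  also have "\<dots> = x" using ab by simp
  finally show ?thesis using B x by metis
qed

lemma kappa_add_right:
  assumes "A \<in> carrier_mat N N" "B \<in> carrier_mat N N" "C \<in> carrier_mat N N"
  shows "kappa A (B + C) = kappa A B + kappa A C"
proof -
  have "B + C \<in> carrier_mat N N" using assms by auto
  thus ?thesis using assms
    by (simp add: kappa_eq[of _ N] distrib_left sum.distrib)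
qed

lemma kappa_diff_left:
  assumes "A \<in> carrier_mat N N" "B \<in> carrier_mat N N" "C \<in> carrier_mat N N"
  shows "kappa (A - B) C = kappa A C - kappa B C"
proof -
  have "A - B \<in> carrier_mat N N" using assms by (simp add: minus_carrier_mat)
  thus ?thesis using assms
    by (simp add: kappa_eq[of _ N] left_diff_distrib sum_subtractf)
qed

lemma character_sum_eq_0:
  fixes D :: "'a :: {field, finite} mat"
  assumes \<theta>: "nontrivial_additive_character \<theta>"
    and D: "D \<in> pattern_space T n" "D \<noteq> 0\<^sub>m (msize T n) (msize T n)"
  shows "(\<Sum>B \<in> pattern_space T n. \<theta> (kappa D B)) = 0"
proof -
  let ?V = "pattern_space T n :: 'a mat set"
  obtain C where C: "C \<in> ?V" "\<theta> (kappa D C) \<noteq> 1" using kappa_nondegenerate[OF \<theta> D] by blast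
  note cc = pattern_space_carrier
  have "bij_betw (\<lambda>B. B + C) ?V ?V"
  proof (rule bij_betwI[where g = "\<lambda>B. B - C"])
    show "(\<lambda>B. B + C) \<in> ?V \<rightarrow> ?V" "(\<lambda>B. B - C) \<in> ?V \<rightarrow> ?V"
      using C pattern_space_add pattern_space_minus by blast+
    show "x + C - C = x" "x - C + C = x" if "x \<in> ?V" for x
      using cc[OF that] cc[OF C(1)] by (auto intro!: eq_matI)
  qed
  hence "(\<Sum>B\<in>?V. \<theta> (kappa D B)) = (\<Sum>B\<in>?V. \<theta> (kappa D (B + C)))"
    by (rule sum.reindex_bij_betw[symmetric])
  also have "\<dots> = (\<Sum>B\<in>?V. \<theta> (kappa D C) * \<theta> (kappa D B))"
    using \<theta> by (intro sum.cong refl)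
      (simp add: kappa_add_right[OF cc[OF D(1)] cc cc[OF C(1)]] nontrivial_additive_character_def
         additive_character_def mult.commute)
  also have "\<dots> = \<theta> (kappa D C) * (\<Sum>B\<in>?V. \<theta> (kappa D B))" by (simp add: sum_distrib_left)
  finally show ?thesis using C(2) by (metis mult_cancel_right1)
qed

lemma lin_char_orthogonal:
  fixes A A' :: "'a :: {field, finite} mat"
  assumes \<theta>: "nontrivial_additive_character \<theta>"
    and A: "A \<in> pattern_space T n" and A': "A' \<in> pattern_space T n"
  shows "(\<Sum>B \<in> pattern_space T n. lin_char T n \<theta> A B * \<theta> (kappa A' B)) =
           (if A = A' then of_nat (card (pattern_space T n :: 'a mat set)) else 0)"
proof -
  note cc = pattern_space_carrier
  have "(\<Sum>B \<in> pattern_space T n. lin_char T n \<theta> A B * \<theta> (kappa A' B))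
      = (\<Sum>B \<in> pattern_space T n. \<theta> (kappa (A' - A) B))"
  proof (intro sum.cong refl)
    fix B :: "'a mat" assume B: "B \<in> pattern_space T n"
    have "kappa (A' - A) B = - kappa A B + kappa A' B"
      using kappa_diff_left[OF cc[OF A'] cc[OF A] cc[OF B]] by simp
    hence "\<theta> (kappa (A' - A) B) = \<theta> (- kappa A B) * \<theta> (kappa A' B)"
      using \<theta> by (simp only: nontrivial_additive_character_def additive_character_def)
    thus "lin_char T n \<theta> A B * \<theta> (kappa A' B) = \<theta> (kappa (A' - A) B)"
      using B by (simp add: lin_char_def)
  qed
  also have "\<dots> = (if A = A' then of_nat (card (pattern_space T n :: 'a mat set)) else 0)"
  proof (cases "A = A'")
    case True
    have "kappa (A' - A) B = 0" if "B \<in> pattern_space T n" for B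
      using kappa_diff_left[OF cc[OF A'] cc[OF A] cc[OF that]] True by simp
    moreover have "\<theta> 0 = 1" using \<theta> by (simp add: nontrivial_additive_character_def character_zero)
    ultimately show ?thesis using True by simp
  next
    case False
    have "A' - A \<noteq> 0\<^sub>m (msize T n) (msize T n)"
    proof
      assume 0: "A' - A = 0\<^sub>m (msize T n) (msize T n)"
      have "A = A'"
      proof (rule eq_matI)
        fix i j assume "i < dim_row A'" "j < dim_col A'"
        hence ij: "i < msize T n" "j < msize T n" using cc[OF A'] by auto
        have "(A' - A) $$ (i, j) = 0" using 0 ij by simp
        thus "A $$ (i, j) = A' $$ (i, j)" using ij cc[OF A] cc[OF A'] by simp
      qed (use cc[OF A] cc[OF A'] in auto)
      thus False using False by simp
    qed
    thus ?thesis
      using False character_sum_eq_0[OF \<theta> pattern_space_minus[OF A' A]] by simp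
  qed
  finally show ?thesis .
qed

lemma card_pattern_space_pos: "card (pattern_space T n :: 'a :: {field, finite} mat set) > 0"
  using pattern_proj_in[of T n "0\<^sub>m 0 0 :: 'a mat"] finite_pattern_space
  by (metis card_gt_0_iff empty_iff)

lemma inj_on_lin_char:
  fixes \<theta> :: "'a :: {field, finite} \<Rightarrow> complex"
  assumes \<theta>: "nontrivial_additive_character \<theta>"
  shows "inj_on (lin_char T n \<theta>) (pattern_space T n)"
proof (rule inj_onI)
  fix A A' :: "'a mat"
  assume A: "A \<in> pattern_space T n" "A' \<in> pattern_space T n" "lin_char T n \<theta> A = lin_char T n \<theta> A'"
  show "A = A'"
    using lin_char_orthogonal[OF \<theta> A(1) A(2)] lin_char_orthogonal[OF \<theta> A(2) A(2)] A(3)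
      card_pattern_space_pos[of T n, where ?'a = 'a] by (auto split: if_splits)
qed

lemma sum_fun_apply: "(\<Sum>x\<in>X. f x) y = (\<Sum>x\<in>X. f x y)"
  for f :: "'b \<Rightarrow> 'c \<Rightarrow> 'd :: comm_monoid_add"
  by (induction X rule: infinite_finite_induct) auto

lemma independent_V_hat:
  fixes \<theta> :: "'a :: {field, finite} \<Rightarrow> complex"
  assumes \<theta>: "nontrivial_additive_character \<theta>"
  shows "cfun.independent (V_hat T n \<theta>)"
proof -
  let ?V = "pattern_space T n :: 'a mat set" and ?l = "lin_char T n \<theta>"
  show ?thesis unfolding cfun.independent_explicit_finite_subsets
  proof (intro allI impI ballI)
    fix S c \<xi> assume S: "S \<subseteq> V_hat T n \<theta>" "finite S" and 0: "(\<Sum>v\<in>S. cscale (c v) v) = 0" and \<xi>: "\<xi> \<in> S"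
    obtain A' where A': "A' \<in> ?V" "\<xi> = ?l A'" using \<xi> S by (auto simp: V_hat_def)
    have "0 = (\<Sum>B\<in>?V. (\<Sum>v\<in>S. cscale (c v) v) B * \<theta> (kappa A' B))" using 0 by simp
    also have "\<dots> = (\<Sum>B\<in>?V. \<Sum>v\<in>S. c v * (v B * \<theta> (kappa A' B)))"
      by (simp add: sum_fun_apply cscale_def sum_distrib_right mult.assoc)
    also have "\<dots> = (\<Sum>v\<in>S. c v * (\<Sum>B\<in>?V. v B * \<theta> (kappa A' B)))"
      by (subst sum.swap) (simp add: sum_distrib_left)
    also have "\<dots> = (\<Sum>v\<in>S. if v = \<xi> then c v * of_nat (card ?V) else 0)"
    proof (intro sum.cong refl)
      fix v assume "v \<in> S"
      then obtain A where A: "A \<in> ?V" "v = ?l A" using S by (auto simp: V_hat_def)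
      have "v = \<xi> \<longleftrightarrow> A = A'" using A A' inj_on_lin_char[OF \<theta>] by (auto dest: inj_onD)
      thus "c v * (\<Sum>B\<in>?V. v B * \<theta> (kappa A' B)) = (if v = \<xi> then c v * of_nat (card ?V) else 0)"
        using lin_char_orthogonal[OF \<theta> A(1) A'(1)] A(2) by simp
    qed
    also have "\<dots> = c \<xi> * of_nat (card ?V)" using S \<xi> by simp
    finally show "c \<xi> = 0" using card_pattern_space_pos[of T n, where ?'a = 'a] by simp
  qed
qed

lemma span_V_hat:
  fixes \<theta> :: "'a :: {field, finite} \<Rightarrow> complex"
  assumes \<theta>: "nontrivial_additive_character \<theta>"
  shows "cfun.span (V_hat T n \<theta>) = {f. \<forall>B. B \<notin> pattern_space T n \<longrightarrow> f B = 0}"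
proof -
  let ?V = "pattern_space T n :: 'a mat set" and ?l = "lin_char T n \<theta>"
  define \<delta> where "\<delta> = (\<lambda>A B :: 'a mat. if A = B then 1 else 0 :: complex)"
  let ?D = "\<delta> ` ?V" and ?W = "{f. \<forall>B. B \<notin> ?V \<longrightarrow> f B = (0 :: complex)}"
  have inj: "inj_on \<delta> ?V" by (auto simp: inj_on_def \<delta>_def fun_eq_iff split: if_splits)
  have sub: "cfun.subspace ?W" by (auto simp: cfun.subspace_def cscale_def)
  have W: "?W \<subseteq> cfun.span ?D"
  proof
    fix f assume f: "f \<in> ?W"
    have "f = (\<Sum>A\<in>?V. cscale (f A) (\<delta> A))"
    proof
      fix B
      show "f B = (\<Sum>A\<in>?V. cscale (f A) (\<delta> A)) B"
        using f finite_pattern_space[of T n, where ?'a = 'a]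
        by (cases "B \<in> ?V") (auto simp: sum_fun_apply cscale_def \<delta>_def if_distrib cong: if_cong)
    qed
    also have "\<dots> \<in> cfun.span ?D" by (intro cfun.span_sum cfun.span_scale cfun.span_base) auto
    finally show "f \<in> cfun.span ?D" .
  qed
  have le: "V_hat T n \<theta> \<subseteq> ?W" by (auto simp: V_hat_def lin_char_def)
  have finW: "finite ?D" by (intro finite_imageI finite_pattern_space)
  have "?W \<subseteq> cfun.span (V_hat T n \<theta>)"
  proof (rule ccontr)
    assume "\<not> ?thesis"
    then obtain f where f: "f \<in> ?W" "f \<notin> cfun.span (V_hat T n \<theta>)" by blast
    have ind: "cfun.independent (insert f (V_hat T n \<theta>))"
      using cfun.independent_insertI[OF f(2) independent_V_hat[OF \<theta>]] .
    have "insert f (V_hat T n \<theta>) \<subseteq> cfun.span ?D" using f le W by blast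
    hence "card (insert f (V_hat T n \<theta>)) \<le> card ?D"
      using cfun.independent_span_bound[OF finW ind] by simp
    moreover have "f \<notin> V_hat T n \<theta>" using f cfun.span_base by blast
    ultimately show False
      using finite_pattern_space[of T n, where ?'a = 'a] card_image[OF inj]
        card_image[OF inj_on_lin_char[OF \<theta>]] by (simp add: V_hat_def)
  qed
  moreover have "cfun.span (V_hat T n \<theta>) \<subseteq> ?W" by (rule cfun.span_minimal[OF le sub])
  ultimately show ?thesis by blast
qed

lemma monomial_action_lin_char:
  fixes \<theta> :: "'a :: {field, finite} \<Rightarrow> complex"
  assumes \<theta>: "nontrivial_additive_character \<theta>" and A: "A \<in> pattern_space T n"
  shows "monomial_action T n \<theta> (lin_char T n \<theta> A) u =
           cscale (\<theta> (- kappa A (inv\<^bsub>mat_ring (msize T n)\<^esub> u))) (lin_char T n \<theta> (char_rep T n A u))"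
proof -
  let ?V = "pattern_space T n :: 'a mat set" and ?l = "lin_char T n \<theta>"
  let ?g = "\<lambda>A. cscale (\<theta> (- kappa A (inv\<^bsub>mat_ring (msize T n)\<^esub> u))) (?l (char_rep T n A u))"
  have "?l A \<in> V_hat T n \<theta>" using A by (simp add: V_hat_def)
  hence "monomial_action T n \<theta> (?l A) u = (\<Sum>A'\<in>?V. cscale (if ?l A' = ?l A then 1 else 0) (?g A'))"
    unfolding monomial_action_def by (subst cfun.representation_basis[OF independent_V_hat[OF \<theta>]]) auto
  also have "\<dots> = (\<Sum>A'\<in>?V. if A' = A then ?g A' else 0)"
  proof (intro sum.cong refl)
    fix A' assume "A' \<in> ?V"
    hence "?l A' = ?l A \<longleftrightarrow> A' = A" using A inj_on_lin_char[OF \<theta>] by (auto dest: inj_onD)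
    thus "cscale (if ?l A' = ?l A then 1 else 0) (?g A') = (if A' = A then ?g A' else 0)"
      by (auto simp: cfun.scale_zero_left cfun.scale_one)
  qed
  also have "\<dots> = ?g A" using A finite_pattern_space[of T n, where ?'a = 'a] by simp
  finally show ?thesis .
qed

lemma monomial_action_linear:
  fixes \<theta> :: "'a :: {field, finite} \<Rightarrow> complex"
  assumes \<theta>: "nontrivial_additive_character \<theta>"
    and f: "f \<in> cfun.span (V_hat T n \<theta>)" and g: "g \<in> cfun.span (V_hat T n \<theta>)"
  shows "monomial_action T n \<theta> (f + g) u = monomial_action T n \<theta> f u + monomial_action T n \<theta> g u"
    and "monomial_action T n \<theta> (cscale c f) u = cscale c (monomial_action T n \<theta> f u)"
  unfolding monomial_action_def cfun.representation_add[OF independent_V_hat[OF \<theta>] g f]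
    cfun.representation_scale[OF independent_V_hat[OF \<theta>] f]
  by (simp_all add: distrib_right mult.assoc cfun.scale_left_distrib sum.distrib cfun.scale_sum_right)

end

theory Submission
  imports Defs "Jordan_Normal_Form.Gauss_Jordan_Elimination"
begin

text \<open>If two main conditions \<open>(i, j)\<close> and \<open>(k, j)\<close> of \<open>A\<close> with \<open>i < k\<close> share a column, add the
  multiple of row \<open>i\<close> to row \<open>k\<close> that clears position \<open>(k, j)\<close>.  The action of \<open>U\<close> moves entries to
  the left, and row \<open>i\<close> vanishes to the right of column \<open>j\<close> on the whole orbit, so nothing is lost by
  truncating to the positions of row \<open>k\<close> and this row operation commutes with the permutation action.
  The two monomial cocycles then differ by a coboundary.  On the level of functions the resulting
  isomorphism is the translation \<open>B \<mapsto> x (B + 1) - 1\<close> by the transvection \<open>x = 1 + \<alpha> e\<^sub>i\<^sub>k\<close>.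
  Each step removes position \<open>(k, j)\<close> from the region to the left of the main conditions, so the
  process ends with a staircase character.\<close>

section \<open>Inverses of unitriangular matrices and the action in coordinates\<close>

text \<open>In \<open>v * u = 1\<close>, column \<open>j\<close> involves only the columns of
  \<open>v\<close> up to \<open>j\<close>, and \<open>v $$ (i, j)\<close> enters with coefficient 1.
  Hence in each row of \<open>v\<close> the entries left of the diagonal vanish one after another,
  and then the diagonal entry must be 1.\<close>

lemma inverse_unitriangular:
  fixes u v :: "'a :: field mat"
  assumes u: "u \<in> unitriangular_grp N" and v: "v \<in> carrier_mat N N" and vu: "v * u = 1\<^sub>m N"
  shows "v \<in> unitriangular_grp N"
proof -
  have uc: "u \<in> carrier_mat N N" and ud: "\<And>i. i < N \<Longrightarrow> u $$ (i, i) = 1"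
    and u0: "\<And>i j. i < N \<Longrightarrow> j < i \<Longrightarrow> u $$ (i, j) = 0"
    using u by (auto simp: unitriangular_grp_def upper_triangular_def)
  have e: "(\<Sum>l<j. v $$ (i, l) * u $$ (l, j)) + v $$ (i, j) = (if i = j then 1 else 0)"
    if ij: "i < N" "j < N" for i j
  proof -
    have "(if i = j then 1 else 0) = (v * u) $$ (i, j)" using vu ij by simp
    also have "\<dots> = (\<Sum>l<N. v $$ (i, l) * u $$ (l, j))"
      using ij uc v by (auto simp: scalar_prod_def atLeast0LessThan intro!: sum.cong)
    also have "\<dots> = (\<Sum>l\<in>{..j}. v $$ (i, l) * u $$ (l, j))"
      using ij u0 by (intro sum.mono_neutral_right) auto
    also have "\<dots> = (\<Sum>l<j. v $$ (i, l) * u $$ (l, j)) + v $$ (i, j)"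
      using ud ij by (simp add: lessThan_Suc_atMost[symmetric])
    finally show ?thesis by simp
  qed
  have z: "j < i \<Longrightarrow> v $$ (i, j) = 0" if "i < N" for i j
  proof (induction j rule: less_induct)
    case (less j)
    have "(\<Sum>l<j. v $$ (i, l) * u $$ (l, j)) = 0" using less by (intro sum.neutral) auto
    thus ?case using e[of i j] less.prems that by simp
  qed
  have "v $$ (i, i) = 1" if "i < N" for i
  proof -
    have "(\<Sum>l<i. v $$ (i, l) * u $$ (l, i)) = 0" using z that by (intro sum.neutral) auto
    thus ?thesis using e[of i i] that by simp
  qed
  thus ?thesis using v z by (auto simp: unitriangular_grp_def upper_triangular_def)
qed

lemma inv_sylow_grp:
  fixes u :: "'a :: field mat"
  assumes "u \<in> sylow_grp T n"
  shows "inv\<^bsub>mat_ring (msize T n)\<^esub> u \<in> unitriangular_grp (msize T n)"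
proof -
  let ?R = "mat_ring (msize T n) :: 'a mat ring"
  interpret ring ?R by (rule ring_mat)
  have u: "u \<in> Units ?R" "u \<in> unitriangular_grp (msize T n)"
    using assms by (auto simp: sylow_grp_def classical_grp_def)
  show ?thesis
    using inverse_unitriangular[OF u(2)] Units_inv_closed[OF u(1)] Units_l_inv[OF u(1)]
    by (simp add: ring_mat_def)
qed

text \<open>The transpose makes \<open>(l, m)\<close> the relevant entry of the inverse, which
  vanishes for \<open>m < l\<close>. So column \<open>l\<close> collects only entries of the same
  row from columns \<open>l\<close> onwards: this is the sense in which the action moves entries to
  the left.\<close>

lemma char_rep_index:
  fixes C :: "'a :: field mat"
  assumes "C \<in> carrier_mat (msize T n) (msize T n)" "u \<in> sylow_grp T n"
    "r < msize T n" "l < msize T n"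
  shows "char_rep T n C u $$ (r, l) = (if (r, l) \<in> positions T n
    then \<Sum>m<msize T n. C $$ (r, m) * (inv\<^bsub>mat_ring (msize T n)\<^esub> u) $$ (l, m) else 0)"
proof -
  have "inv\<^bsub>mat_ring (msize T n)\<^esub> u \<in> carrier_mat (msize T n) (msize T n)"
    using inv_sylow_grp[OF assms(2)] by (simp add: unitriangular_grp_def)
  thus ?thesis using assms
    by (auto simp: char_rep_def pattern_proj_def scalar_prod_def atLeast0LessThan intro!: sum.cong)
qed

section \<open>The shape of the set of positions\<close>

lemma positions_less: "(r, l) \<in> positions T n \<Longrightarrow> r < msize T n \<and> l < msize T n \<and> r < l"
  by (auto simp: positions_def refl_idx_def split: if_splits)

text \<open>The bound \<open>refl_idx T n i\<close> does not increase with \<open>i\<close>, so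
  every column available in row \<open>k\<close> is available in all rows above it. Truncating row
  \<open>i\<close> therefore loses nothing that row \<open>k\<close> could receive from it.\<close>

lemma positions_upward: "(k, l) \<in> positions T n \<Longrightarrow> i \<le> k \<Longrightarrow> (i, l) \<in> positions T n"
  by (auto simp: positions_def refl_idx_def split: if_splits)

lemma positions_leftward: "(k, l) \<in> positions T n \<Longrightarrow> k < m \<Longrightarrow> m \<le> l \<Longrightarrow> (k, m) \<in> positions T n"
  by (auto simp: positions_def split: if_splits)

lemma kappa_eq_rows:
  assumes "A \<in> carrier_mat N N" "B \<in> carrier_mat N N"
  shows "kappa A B = (\<Sum>r<N. \<Sum>l<N. A $$ (r, l) * B $$ (r, l))"
  unfolding kappa_eq[OF assms] by (rule sum.swap)

section \<open>Row operations on characters and transvections on their arguments\<close>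

definition row_op ::
  "classical_type \<Rightarrow> nat \<Rightarrow> 'a :: field \<Rightarrow> nat \<Rightarrow> nat \<Rightarrow> 'a mat \<Rightarrow> 'a mat" where
  "row_op T n \<alpha> i k C = pattern_proj T n (addrow \<alpha> k i C)"

text \<open>Rows \<open>i\<close> and \<open>k\<close> are exchanged compared with
  \<open>row_op\<close>: with respect to \<open>kappa\<close>, the adjoint of left multiplication by
  a matrix is left multiplication by its transpose. The shift by the identity matrix adds the
  constant \<alpha> at position \<open>(i, k)\<close>, so the map is affine and not linear.\<close>

definition transvect :: "nat \<Rightarrow> 'a :: field \<Rightarrow> nat \<Rightarrow> nat \<Rightarrow> 'a mat \<Rightarrow> 'a mat" where
  "transvect N \<alpha> i k B = addrow \<alpha> i k (B + 1\<^sub>m N) - 1\<^sub>m N"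

definition translate ::
  "classical_type \<Rightarrow> nat \<Rightarrow> 'a :: field \<Rightarrow> nat \<Rightarrow> nat \<Rightarrow> ('a mat \<Rightarrow> complex) \<Rightarrow> 'a mat \<Rightarrow> complex" where
  "translate T n \<alpha> i k f =
     (\<lambda>B. if B \<in> pattern_space T n then f (transvect (msize T n) \<alpha> i k B) else 0)"

lemma row_op_in: "row_op T n \<alpha> i k C \<in> pattern_space T n"
  by (simp add: row_op_def pattern_proj_in)

lemma row_op_index:
  assumes "C \<in> pattern_space T n" "i < msize T n" "r < msize T n" "l < msize T n"
  shows "row_op T n \<alpha> i k C $$ (r, l) =
    C $$ (r, l) + (if r = k \<and> (k, l) \<in> positions T n then \<alpha> * C $$ (i, l) else 0)"
  using assms by (auto simp: row_op_def pattern_proj_def pattern_space_def)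

lemma transvect_carrier:
  "B \<in> carrier_mat N N \<Longrightarrow> transvect N \<alpha> i k B \<in> carrier_mat N N"
  by (auto simp: transvect_def)

lemma transvect_index:
  assumes "B \<in> carrier_mat N N" "i \<noteq> k" "k < N" "r < N" "l < N"
  shows "transvect N \<alpha> i k B $$ (r, l) =
    B $$ (r, l) + (if r = i then \<alpha> * (B $$ (k, l) + (if l = k then 1 else 0)) else 0)"
  using assms by (auto simp: transvect_def)

text \<open>Only row \<open>i\<close> changes. What it receives from row \<open>k\<close> of
  \<open>B\<close> stays on positions by \<open>positions_upward\<close>, and the constant lands on
  \<open>(i, k)\<close>.\<close>

lemma transvect_in:
  assumes "B \<in> pattern_space T n" "i < k" "(i, k) \<in> positions T n"
  shows "transvect (msize T n) \<alpha> i k B \<in> pattern_space T n"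
proof -
  note B = pattern_space_carrier[OF assms(1)] and k = positions_less[OF assms(3)]
  have "transvect (msize T n) \<alpha> i k B $$ (r, l) = 0"
    if rl: "r < msize T n" "l < msize T n" "(r, l) \<notin> positions T n" for r l
  proof -
    have "B $$ (r, l) = 0" using assms(1) rl by (auto simp: pattern_space_def)
    moreover have "r = i \<Longrightarrow> l \<noteq> k" using rl assms by auto
    moreover have "r = i \<Longrightarrow> B $$ (k, l) = 0"
      using assms rl k positions_upward[of k l T n i] by (auto simp: pattern_space_def)
    ultimately show ?thesis using transvect_index[OF B, of i k r l \<alpha>] rl k by simp
  qed
  thus ?thesis using transvect_carrier[OF B] by (auto simp: pattern_space_def)
qed

lemma transvect_inverse:
  assumes "B \<in> carrier_mat N N" "i \<noteq> k" "k < N"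
  shows "transvect N \<alpha> i k (transvect N (- \<alpha>) i k B) = B"
  using assms transvect_carrier[OF assms(1), of "- \<alpha>" i k]
    transvect_carrier[OF transvect_carrier[OF assms(1), of "- \<alpha>" i k], of \<alpha> i k]
  by (intro eq_matI) (auto simp: transvect_index[of _ N])

text \<open>Row \<open>i\<close> is left unchanged by the first operation, so the second one
  subtracts exactly the truncated multiple that was added.\<close>

lemma row_op_inverse:
  assumes "C \<in> pattern_space T n" "i \<noteq> k" "i < msize T n"
  shows "row_op T n (- \<alpha>) i k (row_op T n \<alpha> i k C) = C"
proof (rule eq_matI)
  fix r l assume "r < dim_row C" "l < dim_col C"
  hence "r < msize T n" "l < msize T n" using pattern_space_carrier[OF assms(1)] by auto
  thus "row_op T n (- \<alpha>) i k (row_op T n \<alpha> i k C) $$ (r, l) = C $$ (r, l)"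
    using assms by (auto simp: row_op_index row_op_in)
qed (use pattern_space_carrier[OF assms(1)] pattern_space_carrier[OF row_op_in[of T n "- \<alpha>" i k]] in auto)

lemma kappa_row_op:
  assumes "C \<in> pattern_space T n" "B \<in> carrier_mat (msize T n) (msize T n)"
    "i < msize T n" "k < msize T n"
  shows "kappa (row_op T n \<alpha> i k C) B = kappa C B +
    \<alpha> * (\<Sum>l<msize T n. if (k, l) \<in> positions T n then C $$ (i, l) * B $$ (k, l) else 0)"
proof -
  let ?N = "msize T n" and ?s = "\<lambda>l. if (k, l) \<in> positions T n then C $$ (i, l) * B $$ (k, l) else 0"
  have "kappa (row_op T n \<alpha> i k C) B =
    (\<Sum>r<?N. \<Sum>l<?N. C $$ (r, l) * B $$ (r, l) + (if r = k then \<alpha> * ?s l else 0))"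
    unfolding kappa_eq_rows[OF pattern_space_carrier[OF row_op_in] assms(2)]
    using assms by (intro sum.cong refl) (auto simp: row_op_index algebra_simps)
  also have "\<dots> = kappa C B + (\<Sum>r<?N. if r = k then \<Sum>l<?N. \<alpha> * ?s l else 0)"
    unfolding kappa_eq_rows[OF pattern_space_carrier[OF assms(1)] assms(2)]
    by (simp only: sum.distrib) (intro arg_cong2[where f = "(+)"] sum.cong refl, auto)
  finally show ?thesis using assms(4) by (simp add: sum_distrib_left)
qed

lemma kappa_transvect:
  assumes "C \<in> carrier_mat N N" "B \<in> carrier_mat N N" "i \<noteq> k" "i < N" "k < N"
  shows "kappa C (transvect N \<alpha> i k B) =
    kappa C B + \<alpha> * (\<Sum>l<N. C $$ (i, l) * B $$ (k, l)) + \<alpha> * C $$ (i, k)"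
proof -
  let ?s = "\<lambda>l. \<alpha> * (C $$ (i, l) * B $$ (k, l)) + (if l = k then \<alpha> * C $$ (i, k) else 0)"
  have "kappa C (transvect N \<alpha> i k B) =
    (\<Sum>r<N. \<Sum>l<N. C $$ (r, l) * B $$ (r, l) + (if r = i then ?s l else 0))"
    unfolding kappa_eq_rows[OF assms(1) transvect_carrier[OF assms(2)]]
    using assms by (intro sum.cong refl) (auto simp: transvect_index algebra_simps)
  also have "\<dots> = kappa C B + (\<Sum>r<N. if r = i then \<Sum>l<N. ?s l else 0)"
    unfolding kappa_eq_rows[OF assms(1) assms(2)] sum.distrib[of _ _ "{..<N}"]
    by (intro arg_cong2[where f = "(+)"] sum.cong refl) (auto simp: sum.distrib)
  finally show ?thesis using assms by (simp add: sum.distrib sum_distrib_left)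
qed

text \<open>On the pattern space, \<open>row_op\<close> is adjoint to the linear part of
  \<open>transvect\<close>. The constant part of \<open>transvect\<close> produces the scalar
  factor, which later serves as the coboundary between the two cocycles.\<close>

lemma translate_lin_char:
  assumes \<theta>: "additive_character \<theta>" and C: "C \<in> pattern_space T n"
    and ik: "i < k" "(i, k) \<in> positions T n"
  shows "translate T n \<alpha> i k (lin_char T n \<theta> C) =
    cscale (\<theta> (- (\<alpha> * C $$ (i, k)))) (lin_char T n \<theta> (row_op T n \<alpha> i k C))"
proof
  fix B
  let ?N = "msize T n"
  show "translate T n \<alpha> i k (lin_char T n \<theta> C) B =
    cscale (\<theta> (- (\<alpha> * C $$ (i, k)))) (lin_char T n \<theta> (row_op T n \<alpha> i k C)) B"
  proof (cases "B \<in> pattern_space T n")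
    case True
    note cB = pattern_space_carrier[OF True] and cC = pattern_space_carrier[OF C]
      and k = positions_less[OF ik(2)]
    \<comment> \<open>Row \<open>k\<close> of \<open>B\<close> vanishes off the positions, so the
      full sum of \<open>kappa_transvect\<close> equals the truncated sum of
      \<open>kappa_row_op\<close>.\<close>
    have "(\<Sum>l<?N. C $$ (i, l) * B $$ (k, l)) =
      (\<Sum>l<?N. if (k, l) \<in> positions T n then C $$ (i, l) * B $$ (k, l) else 0)"
      using True k by (intro sum.cong refl) (auto simp: pattern_space_def)
    hence "kappa C (transvect ?N \<alpha> i k B) = kappa (row_op T n \<alpha> i k C) B + \<alpha> * C $$ (i, k)"
      using kappa_transvect[OF cC cB, of i k \<alpha>] kappa_row_op[OF C cB, of i k \<alpha>] k ik by simp
    hence "- kappa C (transvect ?N \<alpha> i k B) =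
        - (\<alpha> * C $$ (i, k)) + - kappa (row_op T n \<alpha> i k C) B"
      by simp
    hence "\<theta> (- kappa C (transvect ?N \<alpha> i k B)) =
        \<theta> (- (\<alpha> * C $$ (i, k))) * \<theta> (- kappa (row_op T n \<alpha> i k C) B)"
      using \<theta> by (simp only: additive_character_def)
    thus ?thesis using True transvect_in[OF True ik, of \<alpha>]
      by (simp add: translate_def lin_char_def cscale_def)
  qed (simp add: translate_def lin_char_def cscale_def)
qed

text \<open>Both translations return 0 off the pattern space, which is why \<open>f\<close> is
  required to vanish there.\<close>

lemma translate_inverse:
  assumes ik: "i < k" "(i, k) \<in> positions T n"
    and f: "\<And>B. B \<notin> pattern_space T n \<Longrightarrow> f B = 0"
  shows "translate T n (- \<alpha>) i k (translate T n \<alpha> i k f) = f"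
proof
  fix B
  show "translate T n (- \<alpha>) i k (translate T n \<alpha> i k f) B = f B"
    using f[of B] transvect_in[OF _ ik, of B "- \<alpha>"] positions_less[OF ik(2)]
      transvect_inverse[OF pattern_space_carrier, of B T n i k \<alpha>]
    by (auto simp: translate_def)
qed

section \<open>Compatibility with the permutation action and the cocycle\<close>

text \<open>A row operation multiplies on the left and the action on the right, so the two commute
  before truncation. What remains is to show that no truncated entry contributes to a surviving
  position.\<close>

lemma row_op_char_rep:
  assumes C: "C \<in> pattern_space T n" and u: "u \<in> sylow_grp T n"
    and ik: "i < k" and kj: "(k, j) \<in> positions T n"
    and zero: "\<And>l. j < l \<Longrightarrow> l < msize T n \<Longrightarrow> C $$ (i, l) = 0"
  shows "char_rep T n (row_op T n \<alpha> i k C) u = row_op T n \<alpha> i k (char_rep T n C u)"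
proof (rule eq_matI)
  let ?N = "msize T n" and ?w = "inv\<^bsub>mat_ring (msize T n)\<^esub> u"
  have V: "char_rep T n X u \<in> pattern_space T n" for X
    by (simp add: char_rep_def pattern_proj_in)
  note cC = pattern_space_carrier[OF C] and cC' = pattern_space_carrier[OF row_op_in]
    and kN = positions_less[OF kj]
  fix r l assume "r < dim_row (row_op T n \<alpha> i k (char_rep T n C u))"
    "l < dim_col (row_op T n \<alpha> i k (char_rep T n C u))"
  hence rl: "r < ?N" "l < ?N" by (simp_all add: row_op_def pattern_proj_def)
  have w0: "?w $$ (l, m) = 0" if "m < l" for m
    using inv_sylow_grp[OF u] that rl by (auto simp: unitriangular_grp_def upper_triangular_def)
  have *: "row_op T n \<alpha> i k C $$ (r, m) * ?w $$ (l, m) =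
      C $$ (r, m) * ?w $$ (l, m) + (if r = k then \<alpha> * (C $$ (i, m) * ?w $$ (l, m)) else 0)"
    if "(r, l) \<in> positions T n" "m < ?N" for m
  proof -
    \<comment> \<open>A term truncated from row \<open>k\<close> is harmless. If
      \<open>j < m\<close>, then row \<open>i\<close> is zero at \<open>m\<close>; if
      \<open>m\<close> is at most \<open>j\<close>, then \<open>(k, m)\<close> fails to be a
      position only for \<open>m \<le> k\<close>, hence \<open>m < l\<close>, and the inverse
      vanishes at \<open>(l, m)\<close>.\<close>
    have "(k, m) \<in> positions T n \<or> C $$ (i, m) = 0 \<or> m < l" if "r = k"
      using zero[of m] \<open>m < ?N\<close> positions_leftward[OF kj, of m]
        positions_less[of r l T n] \<open>(r, l) \<in> positions T n\<close> that by (cases "m < l"; cases "j < m") auto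
    thus ?thesis using C rl that w0 ik kN by (auto simp: row_op_index algebra_simps)
  qed
  show "char_rep T n (row_op T n \<alpha> i k C) u $$ (r, l) = row_op T n \<alpha> i k (char_rep T n C u) $$ (r, l)"
  proof (cases "(r, l) \<in> positions T n")
    case True
    have "(\<Sum>m<?N. row_op T n \<alpha> i k C $$ (r, m) * ?w $$ (l, m)) =
      (\<Sum>m<?N. C $$ (r, m) * ?w $$ (l, m) + (if r = k then \<alpha> * (C $$ (i, m) * ?w $$ (l, m)) else 0))"
      by (intro sum.cong refl *[OF True]) auto
    also have "\<dots> = (\<Sum>m<?N. C $$ (r, m) * ?w $$ (l, m)) +
        (if r = k then \<alpha> * (\<Sum>m<?N. C $$ (i, m) * ?w $$ (l, m)) else 0)"
      by (simp add: sum.distrib sum_distrib_left)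
    \<comment> \<open>On the right-hand side row \<open>i\<close> was truncated before being added;
      since \<open>(k, l)\<close> is a position, so is \<open>(i, l)\<close>, and the required entry
      survived.\<close>
    finally show ?thesis
      using True rl ik kN positions_upward[of k l T n i]
      by (auto simp: char_rep_index[OF cC' u] char_rep_index[OF cC u] row_op_index[OF V])
  next
    case False
    thus ?thesis using rl ik kN
      by (auto simp: char_rep_index[OF cC' u] char_rep_index[OF cC u] row_op_index[OF V])
  qed
qed (auto simp: char_rep_def row_op_def pattern_proj_def)

text \<open>Entries move only to the left, so the vanishing assumed for row \<open>i\<close> of one
  matrix holds along its whole orbit.\<close>

lemma char_rep_row_zero:
  assumes C: "C \<in> pattern_space T n" and u: "u \<in> sylow_grp T n" and i: "i < msize T n"
    and zero: "\<And>l. j < l \<Longrightarrow> l < msize T n \<Longrightarrow> C $$ (i, l) = 0"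
    and l: "j < l" "l < msize T n"
  shows "char_rep T n C u $$ (i, l) = 0"
proof -
  let ?w = "inv\<^bsub>mat_ring (msize T n)\<^esub> u"
  have "C $$ (i, m) * ?w $$ (l, m) = 0" if "m < msize T n" for m
    using inv_sylow_grp[OF u] zero[of m] that l
    by (cases "j < m") (auto simp: unitriangular_grp_def upper_triangular_def)
  hence "(\<Sum>m<msize T n. C $$ (i, m) * ?w $$ (l, m)) = 0" by (intro sum.neutral) blast
  thus ?thesis using char_rep_index[OF pattern_space_carrier[OF C] u i l(2)] by simp
qed

text \<open>Entry \<open>(i, k)\<close> of the image of \<open>C\<close> is the product of row
  \<open>i\<close> of \<open>C\<close> with row \<open>k\<close> of the inverse. Its terms left of
  \<open>k\<close> vanish by triangularity, the term at \<open>k\<close> is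
  \<open>C $$ (i, k)\<close>, and those right of \<open>k\<close> form the truncated sum of
  \<open>kappa_row_op\<close>, because row \<open>i\<close> is zero beyond \<open>j\<close>.\<close>

lemma kappa_row_op_coboundary:
  assumes C: "C \<in> pattern_space T n" and u: "u \<in> sylow_grp T n"
    and ik: "i < k" and kj: "(k, j) \<in> positions T n"
    and zero: "\<And>l. j < l \<Longrightarrow> l < msize T n \<Longrightarrow> C $$ (i, l) = 0"
  shows "kappa (row_op T n \<alpha> i k C) (inv\<^bsub>mat_ring (msize T n)\<^esub> u) + \<alpha> * C $$ (i, k) =
    kappa C (inv\<^bsub>mat_ring (msize T n)\<^esub> u) + \<alpha> * char_rep T n C u $$ (i, k)"
proof -
  let ?N = "msize T n" and ?w = "inv\<^bsub>mat_ring (msize T n)\<^esub> u"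
  note kN = positions_less[OF kj]
  have w: "?w \<in> carrier_mat ?N ?N" "?w $$ (k, k) = 1" "\<And>m. m < k \<Longrightarrow> ?w $$ (k, m) = 0"
    using inv_sylow_grp[OF u] kN by (auto simp: unitriangular_grp_def upper_triangular_def)
  have pik: "(i, k) \<in> positions T n"
    using positions_leftward[OF positions_upward[OF kj, of i], of k] ik kN by auto
  have "C $$ (i, l) * ?w $$ (k, l) =
      (if (k, l) \<in> positions T n then C $$ (i, l) * ?w $$ (k, l) else 0) +
      (if l = k then C $$ (i, k) else 0)" if "l < ?N" for l
  proof (cases l k rule: linorder_cases)
    case greater
    thus ?thesis using zero[of l] that positions_leftward[OF kj, of l] by (cases "j < l") auto
  qed (use w positions_less[of k k T n] in auto)
  hence "(\<Sum>l<?N. C $$ (i, l) * ?w $$ (k, l)) =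
      (\<Sum>l<?N. (if (k, l) \<in> positions T n then C $$ (i, l) * ?w $$ (k, l) else 0) +
        (if l = k then C $$ (i, k) else 0))"
    by (intro sum.cong refl) auto
  also have "\<dots> = (\<Sum>l<?N. if (k, l) \<in> positions T n then C $$ (i, l) * ?w $$ (k, l) else 0) +
      C $$ (i, k)"
    using kN by (simp add: sum.distrib)
  finally show ?thesis
    using kappa_row_op[OF C w(1), of i k \<alpha>] ik kN pik
    by (simp add: char_rep_index[OF pattern_space_carrier[OF C] u] distrib_left)
qed

section \<open>The isomorphism of orbit modules\<close>

lemma translate_add:
  "translate T n \<alpha> i k (f + g) = translate T n \<alpha> i k f + translate T n \<alpha> i k g"
  by (auto simp: translate_def fun_eq_iff)

lemma translate_cscale:
  "translate T n \<alpha> i k (cscale c f) = cscale c (translate T n \<alpha> i k f)"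
  by (auto simp: translate_def cscale_def fun_eq_iff)

lemma orbit_module_subset: "orbit_module T n \<theta> A \<subseteq> cfun.span (V_hat T n \<theta>)"
  unfolding orbit_module_def
  by (intro cfun.span_mono) (auto simp: char_orbit_def V_hat_def char_rep_def pattern_proj_in)

text \<open>A generator of the first orbit, obtained from \<open>u\<close>, goes to a scalar
  multiple of the generator of the second orbit obtained from the same \<open>u\<close>.\<close>

lemma translate_orbit_module:
  assumes \<theta>: "additive_character \<theta>" and A: "A \<in> pattern_space T n"
    and ik: "i < k" and kj: "(k, j) \<in> positions T n"
    and zero: "\<And>l. j < l \<Longrightarrow> l < msize T n \<Longrightarrow> A $$ (i, l) = 0"
    and f: "f \<in> orbit_module T n \<theta> A"
  shows "translate T n \<alpha> i k f \<in> orbit_module T n \<theta> (row_op T n \<alpha> i k A)"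
  using f unfolding orbit_module_def
proof (induction rule: cfun.span_induct_alt)
  case base
  have "translate T n \<alpha> i k 0 = 0" by (auto simp: translate_def fun_eq_iff)
  thus ?case by (simp only: cfun.span_zero)
next
  case (step c x y)
  have pik: "(i, k) \<in> positions T n"
    using positions_leftward[OF positions_upward[OF kj, of i], of k] positions_less[OF kj] ik by auto
  obtain u where u: "u \<in> sylow_grp T n" "x = lin_char T n \<theta> (char_rep T n A u)"
    using step by (auto simp: char_orbit_def)
  have "char_rep T n A u \<in> pattern_space T n" by (simp add: char_rep_def pattern_proj_in)
  hence "translate T n \<alpha> i k x = cscale (\<theta> (- (\<alpha> * char_rep T n A u $$ (i, k))))
      (lin_char T n \<theta> (char_rep T n (row_op T n \<alpha> i k A) u))"
    unfolding u(2) using row_op_char_rep[OF A u(1) ik kj zero, of \<alpha>]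
      translate_lin_char[OF \<theta> _ ik pik, of "char_rep T n A u" \<alpha>] by simp
  moreover have "lin_char T n \<theta> (char_rep T n (row_op T n \<alpha> i k A) u) \<in>
      char_orbit T n \<theta> (row_op T n \<alpha> i k A)"
    using u(1) by (auto simp: char_orbit_def)
  ultimately have "translate T n \<alpha> i k x \<in> cfun.span (char_orbit T n \<theta> (row_op T n \<alpha> i k A))"
    by (simp add: cfun.span_scale cfun.span_base)
  thus ?case using step unfolding translate_add translate_cscale by (intro cfun.span_add cfun.span_scale)
qed

text \<open>On a character of the orbit both sides are multiples of one and the same character, and
  the two scalars agree by \<open>kappa_row_op_coboundary\<close>. The general case follows by
  linearity.\<close>

lemma translate_monomial_action:
  fixes \<theta> :: "'a :: {field, finite} \<Rightarrow> complex"
  assumes \<theta>: "nontrivial_additive_character \<theta>" and A: "A \<in> pattern_space T n"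
    and ik: "i < k" and kj: "(k, j) \<in> positions T n"
    and zero: "\<And>l. j < l \<Longrightarrow> l < msize T n \<Longrightarrow> A $$ (i, l) = 0"
    and v: "v \<in> sylow_grp T n" and f: "f \<in> orbit_module T n \<theta> A"
  shows "translate T n \<alpha> i k (monomial_action T n \<theta> f v) =
    monomial_action T n \<theta> (translate T n \<alpha> i k f) v"
proof -
  let ?w = "inv\<^bsub>mat_ring (msize T n)\<^esub> v" and ?t = "translate T n \<alpha> i k"
    and ?S = "cfun.span (V_hat T n \<theta>)" and ?act = "\<lambda>f. monomial_action T n \<theta> f v"
  have add: "additive_character \<theta>" using \<theta> by (simp add: nontrivial_additive_character_def)
  have kN: "i < msize T n" "k < msize T n" using positions_less[OF kj] ik by auto
  have pik: "(i, k) \<in> positions T n"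
    using positions_leftward[OF positions_upward[OF kj, of i], of k] positions_less[OF kj] ik by auto
  \<comment> \<open>The characters span all functions supported on the pattern space, and
    \<open>translate\<close> has values only there.\<close>
  have tS: "?t g \<in> ?S" for g unfolding span_V_hat[OF \<theta>] by (simp add: translate_def)
  have base: "?t (?act x) = ?act (?t x)" if x: "x \<in> char_orbit T n \<theta> A" for x
  proof -
    obtain u where u: "u \<in> sylow_grp T n" "x = lin_char T n \<theta> (char_rep T n A u)"
      using x by (auto simp: char_orbit_def)
    define C where "C = char_rep T n A u"
    have C: "C \<in> pattern_space T n" and Cv: "char_rep T n C v \<in> pattern_space T n"
      by (simp_all add: C_def char_rep_def pattern_proj_in)
    have zC: "\<And>l. j < l \<Longrightarrow> l < msize T n \<Longrightarrow> C $$ (i, l) = 0"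
      unfolding C_def using char_rep_row_zero[OF A u(1) kN(1)] zero by blast
    have "- kappa C ?w + - (\<alpha> * char_rep T n C v $$ (i, k)) =
        - (\<alpha> * C $$ (i, k)) + - kappa (row_op T n \<alpha> i k C) ?w"
      using kappa_row_op_coboundary[OF C v ik kj zC, of \<alpha>] by (simp add: algebra_simps)
    hence coc: "\<theta> (- kappa C ?w) * \<theta> (- (\<alpha> * char_rep T n C v $$ (i, k))) =
        \<theta> (- (\<alpha> * C $$ (i, k))) * \<theta> (- kappa (row_op T n \<alpha> i k C) ?w)"
      using add unfolding additive_character_def by metis
    have lS: "lin_char T n \<theta> (row_op T n \<alpha> i k C) \<in> ?S"
      by (intro cfun.span_base) (simp add: V_hat_def row_op_in)
    have "?t (?act (lin_char T n \<theta> C)) =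
        cscale (\<theta> (- kappa C ?w) * \<theta> (- (\<alpha> * char_rep T n C v $$ (i, k))))
          (lin_char T n \<theta> (row_op T n \<alpha> i k (char_rep T n C v)))"
      unfolding monomial_action_lin_char[OF \<theta> C] translate_cscale translate_lin_char[OF add Cv ik pik]
      by simp
    also have "\<dots> = ?act (?t (lin_char T n \<theta> C))"
      unfolding coc translate_lin_char[OF add C ik pik] monomial_action_linear(2)[OF \<theta> lS lS]
        monomial_action_lin_char[OF \<theta> row_op_in]
      by (simp add: row_op_char_rep[OF C v ik kj zC])
    finally show ?thesis by (simp add: u(2) C_def)
  qed
  \<comment> \<open>Membership in the span is carried through the induction because linearity of the
    monomial action is available only on that span.\<close>
  have "f \<in> ?S \<and> ?t (?act f) = ?act (?t f)"
    using f unfolding orbit_module_def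
  proof (induction rule: cfun.span_induct_alt)
    case base
    have 0: "?act 0 = 0"
      using monomial_action_linear(2)[OF \<theta> cfun.span_zero cfun.span_zero, of T n 0 v] by simp
    have "?t 0 = 0" by (auto simp: translate_def fun_eq_iff)
    thus ?case using 0 by (simp only: cfun.span_zero)
  next
    case (step c x y)
    have xS: "x \<in> ?S" using step(1) orbit_module_subset[of T n \<theta> A]
      by (auto simp: orbit_module_def intro: cfun.span_base)
    have cS: "cscale c x \<in> ?S" using xS by (rule cfun.span_scale)
    have ctS: "cscale c (?t x) \<in> ?S" using tS by (rule cfun.span_scale)
    have yS: "y \<in> ?S" and IH: "?t (?act y) = ?act (?t y)" using step by auto
    have "?t (?act (cscale c x + y)) = cscale c (?act (?t x)) + ?act (?t y)"
      by (simp add: monomial_action_linear(1)[OF \<theta> cS yS] monomial_action_linear(2)[OF \<theta> xS xS]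
          translate_add translate_cscale base[OF step(1)] IH)
    also have "\<dots> = ?act (?t (cscale c x + y))"
      by (simp add: translate_add translate_cscale monomial_action_linear(1)[OF \<theta> ctS tS]
          monomial_action_linear(2)[OF \<theta> tS tS])
    finally show ?case using cfun.span_add[OF cS yS] by blast
  qed
  thus ?thesis by simp
qed

text \<open>The inverse is the translation with parameter \<open>- \<alpha>\<close>: it starts from
  the modified matrix, whose row \<open>i\<close> is still the old one, and
  \<open>row_op_inverse\<close> leads back to \<open>A\<close>.\<close>

lemma CU_isomorphic_row_op:
  fixes \<theta> :: "'a :: {field, finite} \<Rightarrow> complex"
  assumes \<theta>: "nontrivial_additive_character \<theta>" and A: "A \<in> pattern_space T n"
    and ik: "i < k" and kj: "(k, j) \<in> positions T n"
    and zero: "\<And>l. j < l \<Longrightarrow> l < msize T n \<Longrightarrow> A $$ (i, l) = 0"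
  shows "CU_isomorphic T n \<theta> (orbit_module T n \<theta> A) (orbit_module T n \<theta> (row_op T n \<alpha> i k A))"
proof -
  let ?B = "row_op T n \<alpha> i k A"
  have add: "additive_character \<theta>" using \<theta> by (simp add: nontrivial_additive_character_def)
  have iN: "i < msize T n" using positions_less[OF kj] ik by auto
  have pik: "(i, k) \<in> positions T n"
    using positions_leftward[OF positions_upward[OF kj, of i], of k] positions_less[OF kj] ik by auto
  have supp: "g B = 0" if "g \<in> orbit_module T n \<theta> X" "B \<notin> pattern_space T n" for g X B
    using that orbit_module_subset[of T n \<theta> X] span_V_hat[OF \<theta>] by blast
  have zB: "\<And>l. j < l \<Longrightarrow> l < msize T n \<Longrightarrow> ?B $$ (i, l) = 0"
    using zero iN ik A by (auto simp: row_op_index)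
  have "bij_betw (translate T n \<alpha> i k) (orbit_module T n \<theta> A) (orbit_module T n \<theta> ?B)"
  proof (rule bij_betwI[where g = "translate T n (- \<alpha>) i k"])
    show "translate T n \<alpha> i k \<in> orbit_module T n \<theta> A \<rightarrow> orbit_module T n \<theta> ?B"
      using translate_orbit_module[OF add A ik kj zero] by blast
    show "translate T n (- \<alpha>) i k \<in> orbit_module T n \<theta> ?B \<rightarrow> orbit_module T n \<theta> A"
      using translate_orbit_module[OF add row_op_in ik kj zB, of _ "- \<alpha>"] row_op_inverse[OF A _ iN, of k \<alpha>] ik
      by auto
    show "translate T n (- \<alpha>) i k (translate T n \<alpha> i k f) = f" if "f \<in> orbit_module T n \<theta> A" for f
      using translate_inverse[OF ik pik, of f \<alpha>] supp[OF that] by blast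
    show "translate T n \<alpha> i k (translate T n (- \<alpha>) i k f) = f" if "f \<in> orbit_module T n \<theta> ?B" for f
      using translate_inverse[OF ik pik, of f "- \<alpha>"] supp[OF that] by simp
  qed
  thus ?thesis unfolding CU_isomorphic_def
    using translate_monomial_action[OF \<theta> A ik kj zero] translate_add translate_cscale
    by (intro exI[of _ "translate T n \<alpha> i k"]) blast
qed

lemma CU_isomorphic_refl: "CU_isomorphic T n \<theta> M M"
  unfolding CU_isomorphic_def by (rule exI[of _ id]) auto

lemma CU_isomorphic_trans:
  assumes "CU_isomorphic T n \<theta> M M'" "CU_isomorphic T n \<theta> M' M''"
  shows "CU_isomorphic T n \<theta> M M''"
proof -
  obtain \<phi> where \<phi>: "bij_betw \<phi> M M'" "\<forall>f\<in>M. \<forall>g\<in>M. \<phi> (f + g) = \<phi> f + \<phi> g"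
    "\<forall>c. \<forall>f\<in>M. \<phi> (cscale c f) = cscale c (\<phi> f)"
    "\<forall>u\<in>sylow_grp T n. \<forall>f\<in>M. \<phi> (monomial_action T n \<theta> f u) = monomial_action T n \<theta> (\<phi> f) u"
    using assms(1) unfolding CU_isomorphic_def by blast
  obtain \<psi> where \<psi>: "bij_betw \<psi> M' M''" "\<forall>f\<in>M'. \<forall>g\<in>M'. \<psi> (f + g) = \<psi> f + \<psi> g"
    "\<forall>c. \<forall>f\<in>M'. \<psi> (cscale c f) = cscale c (\<psi> f)"
    "\<forall>u\<in>sylow_grp T n. \<forall>f\<in>M'. \<psi> (monomial_action T n \<theta> f u) = monomial_action T n \<theta> (\<psi> f) u"
    using assms(2) unfolding CU_isomorphic_def by blast
  have "\<phi> f \<in> M'" if "f \<in> M" for f using \<phi>(1) that by (auto simp: bij_betw_def)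
  thus ?thesis unfolding CU_isomorphic_def using \<phi> \<psi>
    by (intro exI[of _ "\<psi> \<circ> \<phi>"]) (simp add: bij_betw_trans[of \<phi> M M' \<psi> M''])
qed

section \<open>Termination and conclusion\<close>

text \<open>For \<open>A\<close> in the pattern space, each nonzero row contributes its initial
  segment of columns ending at the main condition. The number of elements is the termination
  measure.\<close>

definition row_hull :: "classical_type \<Rightarrow> nat \<Rightarrow> 'a :: field mat \<Rightarrow> (nat \<times> nat) set" where
  "row_hull T n A =
     {(r, l). r < msize T n \<and> l < msize T n \<and> (\<exists>m. l \<le> m \<and> m < msize T n \<and> A $$ (r, m) \<noteq> 0)}"

lemma finite_row_hull: "finite (row_hull T n A)"
  by (rule finite_subset[of _ "{..<msize T n} \<times> {..<msize T n}"]) (auto simp: row_hull_def)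

lemma row_hull_row_op:
  assumes A: "A \<in> pattern_space T n" and ik: "i < k"
    and ij: "(i, j) \<in> main_conditions T n A" and kj: "(k, j) \<in> main_conditions T n A"
  shows "row_hull T n (row_op T n (- (A $$ (k, j) / A $$ (i, j))) i k A) \<subset> row_hull T n A"
proof -
  let ?N = "msize T n" and ?B = "row_op T n (- (A $$ (k, j) / A $$ (i, j))) i k A"
  have pos: "(i, j) \<in> positions T n" "(k, j) \<in> positions T n"
    and nz: "A $$ (i, j) \<noteq> 0" "A $$ (k, j) \<noteq> 0"
    and zero: "\<And>l. j < l \<Longrightarrow> l < ?N \<Longrightarrow> A $$ (i, l) = 0" "\<And>l. j < l \<Longrightarrow> l < ?N \<Longrightarrow> A $$ (k, l) = 0"
    using ij kj by (auto simp: main_conditions_def)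
  note N = positions_less[OF pos(1)] positions_less[OF pos(2)]
  have B: "?B $$ (r, l) = A $$ (r, l) + (if r = k \<and> (k, l) \<in> positions T n
      then - (A $$ (k, j) / A $$ (i, j)) * A $$ (i, l) else 0)" if "r < ?N" "l < ?N" for r l
    using row_op_index[OF A _ that] N by blast
  \<comment> \<open>At \<open>l = j\<close> the multiplier makes the two entries cancel; beyond
    \<open>j\<close> both rows are already zero.\<close>
  have zB: "?B $$ (k, l) = 0" if "j \<le> l" "l < ?N" for l
    using that N nz zero pos(2) by (cases "l = j") (auto simp: B)
  have "row_hull T n ?B \<subseteq> row_hull T n A"
  proof safe
    fix r l assume "(r, l) \<in> row_hull T n ?B"
    then obtain m where m: "r < ?N" "l < ?N" "l \<le> m" "m < ?N" "?B $$ (r, m) \<noteq> 0"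
      by (auto simp: row_hull_def)
    show "(r, l) \<in> row_hull T n A"
    proof (cases "r = k")
      case True
      hence "l \<le> j" using zB[of m] m by (cases "j \<le> m") auto
      thus ?thesis using True N nz m by (auto simp: row_hull_def)
    next
      case False
      thus ?thesis using m B[of r m] by (auto simp: row_hull_def)
    qed
  qed
  moreover have "(k, j) \<in> row_hull T n A" using N nz by (auto simp: row_hull_def)
  moreover have "(k, j) \<notin> row_hull T n ?B" using zB by (auto simp: row_hull_def)
  ultimately show ?thesis by blast
qed

theorem theorem4p17:
  fixes T :: classical_type and n p m :: nat
    and \<theta> :: "'a :: {field, finite} \<Rightarrow> complex" and A :: "'a mat"
  assumes "prime p" and "odd p" and "card (UNIV :: 'a set) = p ^ m"
    and "nontrivial_additive_character \<theta>"
    and "A \<in> pattern_space T n"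
  shows "\<exists>B \<in> pattern_space T n.
           staircase_character T n \<theta> (lin_char T n \<theta> B) \<and>
           CU_isomorphic T n \<theta> (orbit_module T n \<theta> A) (orbit_module T n \<theta> B)"
  using assms(5)
\<comment> \<open>If no two main conditions share a column, \<open>A\<close> itself is the witness;
  otherwise one row operation shrinks the hull.\<close>
proof (induction "card (row_hull T n A)" arbitrary: A rule: less_induct)
  case less
  show ?case
  proof (cases "inj_on snd (main_conditions T n A)")
    case True
    thus ?thesis using less.prems CU_isomorphic_refl unfolding staircase_character_def by blast
  next
    case False
    \<comment> \<open>The two rows are distinct, and \<open>i\<close> names the upper one.\<close>
    then obtain i k j where ij: "(i, j) \<in> main_conditions T n A"
      and kj: "(k, j) \<in> main_conditions T n A" and ik: "i < k"
      unfolding inj_on_def by (metis linorder_neqE_nat prod.collapse)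
    let ?A' = "row_op T n (- (A $$ (k, j) / A $$ (i, j))) i k A"
    have "card (row_hull T n ?A') < card (row_hull T n A)"
      by (intro psubset_card_mono finite_row_hull row_hull_row_op less.prems ij kj ik)
    then obtain B where B: "B \<in> pattern_space T n" "staircase_character T n \<theta> (lin_char T n \<theta> B)"
      "CU_isomorphic T n \<theta> (orbit_module T n \<theta> ?A') (orbit_module T n \<theta> B)"
      using less.hyps[OF _ row_op_in] by blast
    \<comment> \<open>The main condition \<open>(i, j)\<close> supplies the vanishing of row
      \<open>i\<close> beyond column \<open>j\<close>.\<close>
    have "CU_isomorphic T n \<theta> (orbit_module T n \<theta> A) (orbit_module T n \<theta> ?A')"
      using ij kj by (intro CU_isomorphic_row_op[OF assms(4) less.prems ik, of j])
        (auto simp: main_conditions_def)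
    thus ?thesis using B CU_isomorphic_trans by blast
  qed
qed

end
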